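(* For every integer $n\ge 3$, let $C_n$ denote the cycle on $n$ vertices. Then $\chi'_L(C_n)=3$ if $n=3$, and $\chi'_L(C_n)=4$ if $n\ge 4$.
   Context: All graphs are finite, simple and connected with at least three vertices. For a proper edge coloring $c:E(G)\to\{1,\dots,k\}$ of a graph $G$, let $\pi=(\mathcal{C}_1,\dots,\mathcal{C}_k)$ be the ordered partition of $E(G)$ into color classes. For a vertex $v$ and an edge $e=xy$, $d(v,e)=\min\{d(v,x),d(v,y)\}$, and $d(v,\mathcal{C}_i)=\min\{d(v,e): e\in\mathcal{C}_i\}$. The edge color code of $v$ is $c_\pi(v)=(d(v,\mathcal{C}_1),\dots,d(v,\mathcal{C}_k))$. The coloring $c$ is an edge-locating coloring if distinct vertices have distinct edge color codes; $\chi'_L(G)$ is the minimum $k$ for which $G$ has an edge-locating coloring with $k$ colors. *)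

theory Defs
  imports Main
begin

definition walk :: "'a set set \<Rightarrow> 'a \<Rightarrow> 'a list \<Rightarrow> 'a \<Rightarrow> bool" where
  "walk E u p v \<longleftrightarrow>
     p \<noteq> [] \<and> hd p = u \<and> last p = v \<and> successively (\<lambda>x y. {x, y} \<in> E) p"

locale finite_connected_graph =
  fixes V :: "'a set" and E :: "'a set set"
  assumes finite_V: "finite V"
    and card_V: "card V \<ge> 3"
    and edges: "e \<in> E \<Longrightarrow> e \<subseteq> V \<and> card e = 2"
    and connected: "u \<in> V \<Longrightarrow> v \<in> V \<Longrightarrow> \<exists>p. walk E u p v"

(* The length of a walk is its number of edges, one less than its number of vertices. *)
definition graph_dist :: "'a set set \<Rightarrow> 'a \<Rightarrow> 'a \<Rightarrow> nat" where
  "graph_dist E u v = (LEAST l. \<exists>p. walk E u p v \<and> length p = Suc l)"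

definition dist_edge :: "'a set set \<Rightarrow> 'a \<Rightarrow> 'a set \<Rightarrow> nat" where
  "dist_edge E v e = Min ((\<lambda>x. graph_dist E v x) ` e)"

definition dist_edges :: "'a set set \<Rightarrow> 'a \<Rightarrow> 'a set set \<Rightarrow> nat" where
  "dist_edges E v F = Min ((\<lambda>e. dist_edge E v e) ` F)"

definition color_class :: "'a set set \<Rightarrow> ('a set \<Rightarrow> nat) \<Rightarrow> nat \<Rightarrow> 'a set set" where
  "color_class E c i = {e \<in> E. c e = i}"

(* The color classes form a partition of E, so every one of the k colors is used;
   hence the equality, which also keeps the minimum in dist_edges away from the empty set. *)
definition proper_edge_coloring :: "'a set set \<Rightarrow> nat \<Rightarrow> ('a set \<Rightarrow> nat) \<Rightarrow> bool" where
  "proper_edge_coloring E k c \<longleftrightarrow>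
     c ` E = {1..k} \<and>
     (\<forall>e\<in>E. \<forall>f\<in>E. e \<noteq> f \<and> e \<inter> f \<noteq> {} \<longrightarrow> c e \<noteq> c f)"

definition edge_color_code :: "'a set set \<Rightarrow> nat \<Rightarrow> ('a set \<Rightarrow> nat) \<Rightarrow> 'a \<Rightarrow> nat list" where
  "edge_color_code E k c v = map (\<lambda>i. dist_edges E v (color_class E c i)) [1..<Suc k]"

definition edge_locating_coloring ::
    "'a set \<Rightarrow> 'a set set \<Rightarrow> nat \<Rightarrow> ('a set \<Rightarrow> nat) \<Rightarrow> bool" where
  "edge_locating_coloring V E k c \<longleftrightarrow>
     proper_edge_coloring E k c \<and> inj_on (edge_color_code E k c) V"

definition edge_locating_chromatic_number :: "'a set \<Rightarrow> 'a set set \<Rightarrow> nat" where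
  "edge_locating_chromatic_number V E = (LEAST k. \<exists>c. edge_locating_coloring V E k c)"

definition cycle_verts :: "nat \<Rightarrow> nat set" where
  "cycle_verts n = {0..<n}"

definition cycle_edges :: "nat \<Rightarrow> nat set set" where
  "cycle_edges n = {{i, (i + 1) mod n} | i. i < n}"

lemma walk_snoc:
  assumes "walk E u p v" "{v, w} \<in> E"
  shows "walk E u (p @ [w]) w"
  using assms by (auto simp: walk_def successively_append_iff)

lemma walk_rev:
  assumes "walk E u p v"
  shows "walk E v (rev p) u"
  using assms by (auto simp: walk_def hd_rev last_rev insert_commute)

lemma cycle_walk:
  assumes "i \<le> j" "j < n"
  shows "\<exists>p. walk (cycle_edges n) i p j"
  using assms
proof (induction j rule: dec_induct)
  case base
  have "walk (cycle_edges n) i [i] i" by (simp add: walk_def)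
  then show ?case ..
next
  case (step j)
  then obtain p where p: "walk (cycle_edges n) i p j" by auto
  have "{j, Suc j} \<in> cycle_edges n"
    using step.prems unfolding cycle_edges_def
    by (intro CollectI exI[of _ j]) auto
  then show ?case using walk_snoc[OF p] by blast
qed

lemma finite_connected_graph_cycle:
  assumes "n \<ge> 3"
  shows "finite_connected_graph (cycle_verts n) (cycle_edges n)"
proof
  show "finite (cycle_verts n)" "3 \<le> card (cycle_verts n)"
    using assms by (auto simp: cycle_verts_def)
next
  fix e assume "e \<in> cycle_edges n"
  then obtain i where i: "i < n" "e = {i, (i + 1) mod n}"
    by (auto simp: cycle_edges_def)
  have "(i + 1) mod n \<noteq> i"
  proof (cases "i + 1 = n")
    case True
    then show ?thesis using assms by auto
  next
    case False
    then show ?thesis using i by auto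
  qed
  then show "e \<subseteq> cycle_verts n \<and> card e = 2"
    using i assms by (auto simp: cycle_verts_def)
next
  fix u v assume "u \<in> cycle_verts n" "v \<in> cycle_verts n"
  then show "\<exists>p. walk (cycle_edges n) u p v"
    using cycle_walk[of u v n] cycle_walk[of v u n] walk_rev[of "cycle_edges n" v _ u]
    by (cases "u \<le> v") (auto simp: cycle_verts_def)
qed

end

theory Submission
  imports Defs
begin

text \<open>
  Lower bound: in a locating coloring with three colors, a vertex is incident with two colors and
  misses the third one, so its code is determined by the missed color and the distance to it.
  From a vertex missing color \<open>a\<close>, walk in either direction up to the last vertex
  before the next edge of color \<open>a\<close>. Both walks end at vertices missing \<open>a\<close> at distance \<open>1\<close>;
  these coincide, and this forces the walks to be trivial.
  So each color is missed by at most one vertex, and there are at most three vertices.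
  Upper bound: the distances to two consecutive edges already separate all vertices of a cycle,
  so it suffices to give these two edges private colors and to color the others alternately.
\<close>

section \<open>Distances in the cycle\<close>

text \<open>Certifies a guessed distance function. The Lipschitz bound, summed along an arbitrary
  walk, shows that the walk has at least \<open>f v\<close> edges; following \<open>descent\<close>
  back from \<open>v\<close> to the only zero \<open>u\<close> builds a walk with exactly
  \<open>f v\<close> edges.\<close>

lemma graph_dist_eqI:
  fixes f :: "'a \<Rightarrow> nat"
  assumes start: "f u = 0"
    and lipschitz: "\<And>x y. {x, y} \<in> E \<Longrightarrow> f y \<le> Suc (f x)"
    and zero: "\<And>x. x \<in> V \<Longrightarrow> f x = 0 \<Longrightarrow> x = u"
    and descent: "\<And>y. y \<in> V \<Longrightarrow> f y \<noteq> 0 \<Longrightarrow> \<exists>x\<in>V. {x, y} \<in> E \<and> f y = Suc (f x)"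
    and v: "v \<in> V"
  shows "graph_dist E u v = f v"
proof -
  have walk_ge: "f w < length p" if "walk E u p w" for p w
    using that
  proof (induction p arbitrary: w rule: rev_induct)
    case Nil
    then show ?case by (simp add: walk_def)
  next
    case (snoc y p)
    show ?case
    proof (cases "p = []")
      case True
      then show ?thesis using snoc.prems start by (auto simp: walk_def)
    next
      case False
      then have "walk E u p (last p)" "{last p, w} \<in> E"
        using snoc.prems by (auto simp: walk_def successively_append_iff)
      then show ?thesis using snoc.IH[of "last p"] lipschitz[of "last p" w] by simp
    qed
  qed
  have walk_ex: "\<exists>p. walk E u p w \<and> length p = Suc (f w)" if "w \<in> V" for w
    using that
  proof (induction "f w" arbitrary: w)
    case 0
    then have "w = u" using zero by simp
    then have "walk E u [u] w" by (simp add: walk_def)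
    then show ?case using 0 by (intro exI[of _ "[u]"]) simp
  next
    case (Suc l)
    then obtain x where x: "x \<in> V" "{x, w} \<in> E" "f w = Suc (f x)" using descent[of w] by auto
    then obtain p where "walk E u p x" "length p = Suc (f x)" using Suc by auto
    then show ?case using x walk_snoc[of E u p x w] by (intro exI[of _ "p @ [w]"]) simp
  qed
  show ?thesis unfolding graph_dist_def
    using walk_ex[OF v] walk_ge by (intro Least_equality) force+
qed

text \<open>The length of the shorter arc. Subtraction is truncated, so one of \<open>i - j\<close>
  and \<open>j - i\<close> is 0 and the sum is the absolute difference.\<close>

definition cycle_dist :: "nat \<Rightarrow> nat \<Rightarrow> nat \<Rightarrow> nat" where
  "cycle_dist n i j = (let d = (i - j) + (j - i) in min d (n - d))"

text \<open>Trades \<open>mod\<close> for explicit wrap-around cases, which arithmetic handles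
  directly.\<close>

lemma mem_cycle_edges_iff:
  assumes "n \<ge> 3"
  shows "{x, y} \<in> cycle_edges n \<longleftrightarrow>
    x < n \<and> y < n \<and> (y = Suc x \<or> x = Suc y \<or> x = 0 \<and> Suc y = n \<or> y = 0 \<and> Suc x = n)"
proof -
  have succ: "y = (x + 1) mod n \<longleftrightarrow> y < n \<and> (y = Suc x \<or> y = 0 \<and> Suc x = n)" if "x < n" for x y
    using that by (cases "Suc x = n") auto
  have "{x, y} \<in> cycle_edges n \<longleftrightarrow> x < n \<and> y = (x + 1) mod n \<or> y < n \<and> x = (y + 1) mod n"
    unfolding cycle_edges_def mem_Collect_eq doubleton_eq_iff by blast
  then show ?thesis using succ[of x y] succ[of y x] by argo
qed

lemma cycle_dist_eq_0_iff:
  assumes "i < n" "j < n"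
  shows "cycle_dist n i j = 0 \<longleftrightarrow> i = j"
  using assms by (cases i j rule: linorder_cases) (auto simp: cycle_dist_def Let_def min_def)

text \<open>Moving \<open>j\<close> by one step lengthens one of the two arcs by one and shortens
  the other by one, so their minimum changes by at most one.\<close>

lemma cycle_dist_Suc:
  assumes "i < n" "Suc j < n"
  shows "cycle_dist n i (Suc j) \<le> Suc (cycle_dist n i j)"
    and "cycle_dist n i j \<le> Suc (cycle_dist n i (Suc j))"
proof -
  have step: "min (Suc p) (n - Suc p) \<le> Suc (min p (n - p))"
    "min p (n - p) \<le> Suc (min (Suc p) (n - Suc p))" for p
    by linarith+
  have "cycle_dist n i (Suc j) \<le> Suc (cycle_dist n i j) \<and>
    cycle_dist n i j \<le> Suc (cycle_dist n i (Suc j))"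
  proof (cases "i \<le> j")
    case True
    define p where "p = j - i"
    have "cycle_dist n i j = min p (n - p)" "cycle_dist n i (Suc j) = min (Suc p) (n - Suc p)"
      using True by (simp_all add: cycle_dist_def p_def Suc_diff_le)
    then show ?thesis using step[of p] by simp
  next
    case False
    define p where "p = i - Suc j"
    have "i - j = Suc p" using False by (simp add: p_def)
    then have "cycle_dist n i j = min (Suc p) (n - Suc p)" "cycle_dist n i (Suc j) = min p (n - p)"
      using False by (simp_all add: cycle_dist_def p_def)
    then show ?thesis using step[of p] by simp
  qed
  then show "cycle_dist n i (Suc j) \<le> Suc (cycle_dist n i j)"
    "cycle_dist n i j \<le> Suc (cycle_dist n i (Suc j))" by simp_all
qed

lemma cycle_dist_wrap:
  assumes "i < n" "Suc j = n"
  shows "cycle_dist n i 0 \<le> Suc (cycle_dist n i j)"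
    and "cycle_dist n i j \<le> Suc (cycle_dist n i 0)"
proof -
  \<comment> \<open>The paths from \<open>i\<close> to \<open>0\<close> and to \<open>n - 1\<close>
    have lengths \<open>i\<close> and \<open>r\<close>; the edge between \<open>n - 1\<close> and
    \<open>0\<close> extends either of them by one.\<close>
  define r where "r = j - i"
  have n: "n = Suc (i + r)" using assms by (simp add: r_def)
  then have "cycle_dist n i 0 = min i (Suc r)" "cycle_dist n i j = min r (Suc i)"
    using assms by (simp_all add: cycle_dist_def)
  then show "cycle_dist n i 0 \<le> Suc (cycle_dist n i j)"
    "cycle_dist n i j \<le> Suc (cycle_dist n i 0)" by auto
qed

text \<open>Going down from \<open>v\<close> one meets the edge first at \<open>Suc i\<close>, going
  up and around one meets it first at \<open>i\<close>. This yields the code entries in the upper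
  bound.\<close>

lemma cycle_dist_edge:
  assumes "i < v" "v < n"
  shows "min (cycle_dist n v i) (cycle_dist n v (Suc i)) = min (v - Suc i) (n - (v - i))"
proof -
  define p q where "p = v - Suc i" and "q = n - (v - i)"
  have "v - i = Suc p" "n - Suc p = q" "n - p = Suc q" using assms by (auto simp: p_def q_def)
  then have "cycle_dist n v i = min (Suc p) q" "cycle_dist n v (Suc i) = min p (Suc q)"
    using assms p_def by (simp_all add: cycle_dist_def)
  then show ?thesis by (simp add: p_def[symmetric] q_def[symmetric])
qed

lemma cycle_dist_descent:
  assumes "i < n" "j < n" "cycle_dist n i j \<noteq> 0"
  shows "\<exists>x<n. (j = Suc x \<or> x = Suc j \<or> x = 0 \<and> Suc j = n \<or> j = 0 \<and> Suc x = n) \<and>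
    cycle_dist n i j = Suc (cycle_dist n i x)"
proof -
  \<comment> \<open>The neighbor to choose lies one step back along a shortest arc. Cases 1 and 4
    use the arc that avoids the edge between \<open>n - 1\<close> and \<open>0\<close>; the others
    use the complementary arc, whose next step crosses that edge in cases 3 and 6.\<close>
  consider "i < j" "j - i \<le> n - (j - i)" | "i < j" "n - (j - i) < j - i" "Suc j < n"
    | "i < j" "n - (j - i) < j - i" "Suc j = n"
    | "j < i" "i - j \<le> n - (i - j)" | "j < i" "n - (i - j) < i - j" "j > 0"
    | "j < i" "n - (i - j) < i - j" "j = 0"
    using assms by (cases i j rule: linorder_cases) (force simp: cycle_dist_def)+
  then show ?thesis
  proof cases
    case 1
    then show ?thesis using assms
      by (intro exI[of _ "j - 1"]) (auto simp: cycle_dist_def Let_def min_def)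
  next
    case 2
    then show ?thesis using assms
      by (intro exI[of _ "Suc j"]) (auto simp: cycle_dist_def Let_def min_def)
  next
    case 3
    then show ?thesis using assms
      by (intro exI[of _ 0]) (auto simp: cycle_dist_def Let_def min_def)
  next
    case 4
    then show ?thesis using assms
      by (intro exI[of _ "Suc j"]) (auto simp: cycle_dist_def Let_def min_def)
  next
    case 5
    then show ?thesis using assms
      by (intro exI[of _ "j - 1"]) (auto simp: cycle_dist_def Let_def min_def)
  next
    case 6
    then show ?thesis using assms
      by (intro exI[of _ "n - 1"]) (auto simp: cycle_dist_def Let_def min_def)
  qed
qed

lemma graph_dist_cycle:
  assumes "n \<ge> 3" "i < n" "j < n"
  shows "graph_dist (cycle_edges n) i j = cycle_dist n i j"
proof (rule graph_dist_eqI[where V = "{..<n}"])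
  show "cycle_dist n i i = 0" by (simp add: cycle_dist_def)
  show "cycle_dist n i y \<le> Suc (cycle_dist n i x)" if "{x, y} \<in> cycle_edges n" for x y
  proof -
    have "x < n" "y < n" "y = Suc x \<or> x = Suc y \<or> x = 0 \<and> Suc y = n \<or> y = 0 \<and> Suc x = n"
      using that assms by (simp_all add: mem_cycle_edges_iff)
    then consider "y = Suc x" | "x = Suc y" | "x = 0" "Suc y = n" | "y = 0" "Suc x = n" by blast
    then show ?thesis
      using cycle_dist_Suc[of i n x] cycle_dist_Suc[of i n y] cycle_dist_wrap[of i n x]
        cycle_dist_wrap[of i n y] assms \<open>x < n\<close> \<open>y < n\<close>
      by cases blast+
  qed
  show "x = i" if "x \<in> {..<n}" "cycle_dist n i x = 0" for x
    using that assms cycle_dist_eq_0_iff[of i n x] by simp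
  show "\<exists>x\<in>{..<n}. {x, y} \<in> cycle_edges n \<and> cycle_dist n i y = Suc (cycle_dist n i x)"
    if "y \<in> {..<n}" "cycle_dist n i y \<noteq> 0" for y
    using that cycle_dist_descent[of i n y] assms by (fastforce simp: mem_cycle_edges_iff)
qed (use assms in auto)

section \<open>Distances 0 and 1 from a vertex to a set of edges\<close>

lemma finite_cycle_edges: "finite (cycle_edges n)"
  unfolding cycle_edges_def by simp

lemma cycle_edge_subset:
  assumes "n \<ge> 3" "e \<in> cycle_edges n"
  shows "e \<subseteq> {..<n}" "finite e" "e \<noteq> {}"
  using assms unfolding cycle_edges_def by auto

text \<open>A minimum of natural numbers over a finite nonempty set is 0 only if 0 is attained, and
  in the cycle distance 0 means equality of vertices. Nonemptiness of \<open>F\<close> keeps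
  \<open>Min {}\<close> out.\<close>

lemma dist_edges_eq_0_iff:
  assumes n: "n \<ge> 3" "v < n" and F: "F \<subseteq> cycle_edges n" "F \<noteq> {}"
  shows "dist_edges (cycle_edges n) v F = 0 \<longleftrightarrow> (\<exists>e\<in>F. v \<in> e)"
proof -
  have Min_0: "Min A = 0 \<longleftrightarrow> 0 \<in> A" if "finite A" "A \<noteq> {}" for A :: "nat set"
    using that by (metis Min_in Min_le le_zero_eq)
  have "dist_edge (cycle_edges n) v e = 0 \<longleftrightarrow> v \<in> e" if "e \<in> F" for e
  proof -
    have e: "e \<subseteq> {..<n}" "finite e" "e \<noteq> {}" using cycle_edge_subset[OF n(1)] that F by blast+
    have "graph_dist (cycle_edges n) v x = 0 \<longleftrightarrow> v = x" if "x \<in> e" for x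
      using that e n by (auto simp: subset_iff graph_dist_cycle cycle_dist_eq_0_iff)
    then show ?thesis using e by (auto simp: dist_edge_def Min_0 image_iff)
  qed
  moreover have "finite F" using F finite_cycle_edges finite_subset by blast
  ultimately show ?thesis using F by (auto simp: dist_edges_def Min_0 image_iff)
qed

text \<open>The neighbor \<open>y\<close> on an edge of \<open>F\<close> bounds the distance by 1,
  and avoiding \<open>F\<close> excludes 0.\<close>

lemma dist_edges_eq_1:
  assumes n: "n \<ge> 3" "v < n" and F: "F \<subseteq> cycle_edges n"
    and avoid: "\<And>e. e \<in> F \<Longrightarrow> v \<notin> e"
    and near: "e \<in> F" "y \<in> e" "{v, y} \<in> cycle_edges n"
  shows "dist_edges (cycle_edges n) v F = 1"
proof -
  have e: "e \<subseteq> {..<n}" "finite e" using cycle_edge_subset[OF n(1)] near F by blast+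
  have "finite F" using F finite_cycle_edges finite_subset by blast
  then have "dist_edges (cycle_edges n) v F \<le> dist_edge (cycle_edges n) v e"
    using near by (simp add: dist_edges_def)
  also have "\<dots> \<le> graph_dist (cycle_edges n) v y" using e near by (simp add: dist_edge_def)
  also have "\<dots> = cycle_dist n v y" using graph_dist_cycle n e near by auto
  also have "\<dots> \<le> 1"
    using near(3) n by (auto simp: mem_cycle_edges_iff cycle_dist_def Let_def min_def)
  finally show ?thesis using dist_edges_eq_0_iff[OF n F] avoid near(1) by fastforce
qed

lemma edge_color_code_eq_iff:
  "edge_color_code E k c v = edge_color_code E k c w \<longleftrightarrow>
    (\<forall>i\<in>{1..k}. dist_edges E v (color_class E c i) = dist_edges E w (color_class E c i))"
  unfolding edge_color_code_def map_eq_conv set_upt atLeastLessThanSuc_atLeastAtMost ..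

text \<open>Integer indices let one walk around the cycle in both directions without wrapping.\<close>

definition cyc_vert :: "nat \<Rightarrow> int \<Rightarrow> nat" where
  "cyc_vert n i = nat (i mod int n)"

definition cyc_edge :: "nat \<Rightarrow> int \<Rightarrow> nat set" where
  "cyc_edge n i = {cyc_vert n i, cyc_vert n (i + 1)}"

lemma cyc_vert_less: "n > 0 \<Longrightarrow> cyc_vert n i < n"
  by (simp add: cyc_vert_def nat_less_iff)

lemma cyc_vert_of_nat: "v < n \<Longrightarrow> cyc_vert n (int v) = v"
  by (simp add: cyc_vert_def)

lemma cyc_vert_eq_iff: "n > 0 \<Longrightarrow> cyc_vert n i = cyc_vert n j \<longleftrightarrow> i mod int n = j mod int n"
  by (simp add: cyc_vert_def eq_nat_nat_iff)

lemma cyc_vert_add_eq_iff: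
  "n > 0 \<Longrightarrow> cyc_vert n (i + a) = cyc_vert n (i + b) \<longleftrightarrow> int n dvd a - b"
  by (simp add: cyc_vert_eq_iff mod_eq_dvd_iff)

lemma cyc_edge_cong:
  assumes "n > 0" "i mod int n = j mod int n"
  shows "cyc_edge n i = cyc_edge n j"
proof -
  have "cyc_vert n i = cyc_vert n j" "cyc_vert n (i + 1) = cyc_vert n (j + 1)"
    using assms mod_add_cong[of i "int n" j 1 1] by (simp_all add: cyc_vert_eq_iff)
  then show ?thesis by (simp add: cyc_edge_def)
qed

lemma cyc_edge_of_nat:
  assumes "i < n"
  shows "cyc_edge n (int i) = {i, (i + 1) mod n}"
  using assms
  by (simp add: cyc_edge_def cyc_vert_of_nat) (simp add: cyc_vert_def nat_mod_as_int add.commute)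

lemma cycle_edges_eq_range:
  assumes "n > 0"
  shows "cycle_edges n = range (cyc_edge n)"
proof -
  have "cyc_edge n i \<in> cycle_edges n" for i
  proof -
    have "cyc_edge n i = cyc_edge n (int (cyc_vert n i))"
      using assms by (intro cyc_edge_cong) (simp_all add: cyc_vert_def)
    then show ?thesis
      using cyc_vert_less[OF assms] cyc_edge_of_nat[of "cyc_vert n i" n]
      unfolding cycle_edges_def by blast
  qed
  moreover have "e \<in> range (cyc_edge n)" if "e \<in> cycle_edges n" for e
  proof -
    obtain i where "i < n" "e = {i, (i + 1) mod n}" using \<open>e \<in> cycle_edges n\<close>
      unfolding cycle_edges_def by blast
    then show ?thesis using cyc_edge_of_nat by (metis rangeI)
  qed
  ultimately show ?thesis by blast
qed

lemma cyc_vert_incident: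
  assumes "n > 0" "e \<in> cycle_edges n"
  shows "cyc_vert n i \<in> e \<longleftrightarrow> e = cyc_edge n (i - 1) \<or> e = cyc_edge n i"
proof
  assume i: "cyc_vert n i \<in> e"
  obtain j where j: "e = cyc_edge n j" using assms by (auto simp: cycle_edges_eq_range)
  consider "i mod int n = j mod int n" | "i mod int n = (j + 1) mod int n"
    using i j assms by (auto simp: cyc_edge_def cyc_vert_eq_iff)
  then show "e = cyc_edge n (i - 1) \<or> e = cyc_edge n i"
  proof cases
    case 1
    then show ?thesis using j cyc_edge_cong[OF assms(1) 1] by simp
  next
    case 2
    then have "(i - 1) mod int n = j mod int n"
      using mod_diff_cong[of i "int n" "j + 1" 1 1] by simp
    then show ?thesis using j cyc_edge_cong[OF assms(1)] by blast
  qed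
qed (auto simp: cyc_edge_def)

lemma cyc_edge_adjacent:
  assumes "n \<ge> 3"
  shows "cyc_edge n (i - 1) \<noteq> cyc_edge n i" "cyc_edge n (i - 1) \<inter> cyc_edge n i \<noteq> {}"
proof -
  \<comment> \<open>This is where \<open>n \<ge> 3\<close> enters: in a cycle of length 2 the outer
    ends \<open>i - 1\<close> and \<open>i + 1\<close> would coincide, and so would the two
    edges.\<close>
  have "\<not> int n dvd 2" "\<not> int n dvd 1" using assms by (auto dest!: zdvd_imp_le)
  then have "cyc_vert n (i - 1) \<noteq> cyc_vert n (i + 1)" "cyc_vert n (i - 1) \<noteq> cyc_vert n i"
    using assms cyc_vert_add_eq_iff[of n "i - 1" 0 2] cyc_vert_add_eq_iff[of n "i - 1" 0 1]
    by (simp_all add: algebra_simps)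
  then show "cyc_edge n (i - 1) \<noteq> cyc_edge n i"
    by (auto simp: cyc_edge_def doubleton_eq_iff)
qed (simp add: cyc_edge_def)

section \<open>Lower bound: vertices that miss a color\<close>

text \<open>Read \<open>g i\<close> as the color of the edge from vertex \<open>i\<close> to vertex
  \<open>i + 1\<close>. Then vertex \<open>i\<close> misses \<open>a\<close> if
  \<open>g (i - 1)\<close> and \<open>g i\<close> differ from \<open>a\<close>, and
  \<open>near_unique\<close> concerns such vertices with an edge of color \<open>a\<close> right
  behind or ahead. Comparing the two ends of a run of edges without \<open>a\<close> shows that
  every vertex missing \<open>a\<close> is of this kind.\<close>

lemma missing_vertices_cong:
  fixes g :: "int \<Rightarrow> 'a" and m :: int
  assumes periodic: "\<And>i j. i mod m = j mod m \<Longrightarrow> g i = g j"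
    and occurs: "g i0 = a" and m: "m > 0"
    and near_unique: "\<And>i j. \<lbrakk>g (i - 1) \<noteq> a; g i \<noteq> a; g (i + 1) = a \<or> g (i - 2) = a;
      g (j - 1) \<noteq> a; g j \<noteq> a; g (j + 1) = a \<or> g (j - 2) = a\<rbrakk> \<Longrightarrow> i mod m = j mod m"
    and missing: "g (v - 1) \<noteq> a" "g v \<noteq> a" "g (w - 1) \<noteq> a" "g w \<noteq> a"
  shows "v mod m = w mod m"
proof -
  have near: "g (v + 1) = a" if v: "g (v - 1) \<noteq> a" "g v \<noteq> a" for v
  proof -
    \<comment> \<open>The residue is a nonnegative offset, so periodicity puts an occurrence of
      \<open>a\<close> ahead of \<open>v\<close>; \<open>k\<close> is the least such offset.\<close>
    have "g (v + ((i0 - v) mod m)) = a"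
      using occurs periodic[of "v + ((i0 - v) mod m)" i0] by (simp add: mod_add_right_eq)
    then have "\<exists>k::nat. g (v + int k) = a"
      using m by (intro exI[of _ "nat ((i0 - v) mod m)"]) simp
    then obtain k :: nat where k: "g (v + int k) = a"
      and k_min: "\<And>l. l < k \<Longrightarrow> g (v + int l) \<noteq> a"
      using exists_least_iff[of "\<lambda>k. g (v + int k) = a"] by blast
    have "k > 0" using k v by (cases k) auto
    \<comment> \<open>The next edge of color \<open>a\<close> is \<open>u + 1\<close>, so
      \<open>u\<close> is the last vertex ahead of \<open>v\<close> in this run that still misses
      \<open>a\<close>.\<close>
    define u where "u = v + int k - 1"
    have u: "g u \<noteq> a" "g (u + 1) = a" "g (u - 1) \<noteq> a"
    proof -
      show "g u \<noteq> a" using k_min[of "k - 1"] \<open>k > 0\<close> by (simp add: u_def of_nat_diff algebra_simps)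
      show "g (u + 1) = a" using k by (simp add: u_def)
      show "g (u - 1) \<noteq> a"
      proof (cases "k = 1")
        case True
        then show ?thesis using v by (simp add: u_def)
      next
        case False
        then show ?thesis using k_min[of "k - 2"] \<open>k > 0\<close>
          by (simp add: u_def of_nat_diff algebra_simps)
      qed
    qed
    have "g (u - 1 - ((u - 1 - i0) mod m)) = a"
      using occurs periodic[of "u - 1 - ((u - 1 - i0) mod m)" i0] by (simp add: mod_diff_right_eq)
    then have "\<exists>l::nat. g (u - 1 - int l) = a"
      using m by (intro exI[of _ "nat ((u - 1 - i0) mod m)"]) simp
    then obtain l :: nat where l: "g (u - 1 - int l) = a"
      and l_min: "\<And>j. j < l \<Longrightarrow> g (u - 1 - int j) \<noteq> a"
      using exists_least_iff[of "\<lambda>l. g (u - 1 - int l) = a"] by blast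
    have "l > 0" using l u by (cases l) auto
    \<comment> \<open>Mirror image of \<open>u\<close>: the last edge of color \<open>a\<close>
      behind \<open>u\<close> is \<open>t - 2\<close>, so \<open>t\<close> is the first vertex of
      the same run that misses \<open>a\<close>.\<close>
    define t where "t = u + 1 - int l"
    have t: "g (t - 2) = a" "g (t - 1) \<noteq> a" "g t \<noteq> a"
    proof -
      show "g (t - 2) = a" using l by (simp add: t_def algebra_simps)
      show "g (t - 1) \<noteq> a" using l_min[of "l - 1"] \<open>l > 0\<close>
        by (simp add: t_def of_nat_diff algebra_simps)
      show "g t \<noteq> a"
      proof (cases "l = 1")
        case True
        then show ?thesis using u by (simp add: t_def)
      next
        case False
        then show ?thesis using l_min[of "l - 2"] \<open>l > 0\<close>
          by (simp add: t_def of_nat_diff algebra_simps)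
      qed
    qed
    have "u mod m = t mod m" using near_unique u t by blast
    then have "g (u - 2) = a" using periodic[of "u - 2" "t - 2"] t mod_diff_cong by metis
    have "k = 1"
    proof (rule ccontr)
      assume "k \<noteq> 1"
      then consider "k = 2" | "k \<ge> 3" using \<open>k > 0\<close> by linarith
      then show False
      proof cases
        case 1
        then show ?thesis using \<open>g (u - 2) = a\<close> v by (simp add: u_def)
      next
        case 2
        then show ?thesis using \<open>g (u - 2) = a\<close> k_min[of "k - 3"]
          by (simp add: u_def of_nat_diff algebra_simps)
      qed
    qed
    then show ?thesis using k by simp
  qed
  show ?thesis using near_unique near missing by blast
qed

lemma locating_coloring_cycle_lower:
  assumes n: "n \<ge> 3" and c: "edge_locating_coloring (cycle_verts n) (cycle_edges n) k c"
  shows "k \<ge> (if n = 3 then 3 else 4)"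
proof -
  let ?E = "cycle_edges n"
  have n0: "n > 0" using n by simp
  define g where "g i = c (cyc_edge n i)" for i
  have colors: "c ` ?E = {1..k}"
    and proper: "\<And>e f. e \<in> ?E \<Longrightarrow> f \<in> ?E \<Longrightarrow> e \<noteq> f \<Longrightarrow> e \<inter> f \<noteq> {} \<Longrightarrow> c e \<noteq> c f"
    and inj: "inj_on (edge_color_code ?E k c) {0..<n}"
    using c unfolding edge_locating_coloring_def proper_edge_coloring_def cycle_verts_def
    by blast+
  have edge: "cyc_edge n i \<in> ?E" for i using n0 by (simp add: cycle_edges_eq_range)
  have g_neq: "g (i - 1) \<noteq> g i" for i
    unfolding g_def by (rule proper[OF edge edge cyc_edge_adjacent[OF n]])
  have g_in: "g i \<in> {1..k}" for i unfolding g_def using colors edge by blast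
  have dist_0: "dist_edges ?E (cyc_vert n i) (color_class ?E c a) = 0 \<longleftrightarrow> a = g (i - 1) \<or> a = g i"
    if "a \<in> {1..k}" for a i
  proof -
    have "a \<in> c ` ?E" using that colors by simp
    then have of_class: "color_class ?E c a \<subseteq> ?E" "color_class ?E c a \<noteq> {}"
      by (auto simp: color_class_def)
    have incident: "e \<in> color_class ?E c a \<and> cyc_vert n i \<in> e \<longleftrightarrow>
        c e = a \<and> (e = cyc_edge n (i - 1) \<or> e = cyc_edge n i)" for e
      using edge[of "i - 1"] edge[of i] cyc_vert_incident[OF n0, of e i]
      unfolding color_class_def by blast
    have "dist_edges ?E (cyc_vert n i) (color_class ?E c a) = 0 \<longleftrightarrow>
        (\<exists>e. e \<in> color_class ?E c a \<and> cyc_vert n i \<in> e)"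
      unfolding dist_edges_eq_0_iff[OF n cyc_vert_less[OF n0] of_class] by blast
    also have "\<dots> \<longleftrightarrow> a = g (i - 1) \<or> a = g i"
      unfolding incident g_def by metis
    finally show ?thesis .
  qed
  have same_vertex: "cyc_vert n i = cyc_vert n j"
    if "\<And>a. a \<in> {1..k} \<Longrightarrow> dist_edges ?E (cyc_vert n i) (color_class ?E c a)
      = dist_edges ?E (cyc_vert n j) (color_class ?E c a)" for i j
    using that inj cyc_vert_less[OF n0] by (auto simp: inj_on_def edge_color_code_eq_iff)
  have "k \<ge> 3"
  \<comment> \<open>With fewer than three colors, the two differently colored edges at each vertex
    show all colors, so all codes consist of zeros.\<close>
  proof (rule ccontr)
    assume k: "\<not> k \<ge> 3"
    have "a = x \<or> a = y" if "a \<in> {1..k}" "x \<in> {1..k}" "y \<in> {1..k}" "x \<noteq> y" for a x y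
      using that k unfolding atLeastAtMost_iff by presburger
    then have "a = g (i - 1) \<or> a = g i" if "a \<in> {1..k}" for a i
      using that g_neq g_in by blast
    then have "dist_edges ?E (cyc_vert n i) (color_class ?E c a) = 0" if "a \<in> {1..k}" for a i
      using that dist_0 by blast
    then have "cyc_vert n 0 = cyc_vert n 1"
      by (intro same_vertex) simp
    then show False using cyc_vert_of_nat[of 0 n] cyc_vert_of_nat[of 1 n] n by simp
  qed
  moreover have "n = 3" if k: "k = 3"
  proof -
    have "\<exists>a\<in>{1..k}. a \<noteq> g (i - 1) \<and> a \<noteq> g i" for i
    proof -
      have "card {g (i - 1), g i} \<le> 2" by (simp add: card_insert_if)
      then have "\<not> {1..k} \<subseteq> {g (i - 1), g i}"
        using k card_mono[of "{g (i - 1), g i}" "{1..k}"] by auto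
      then show ?thesis by blast
    qed
    then obtain miss where miss: "\<And>i. miss i \<in> {1..k}" "\<And>i. miss i \<noteq> g (i - 1)" "\<And>i. miss i \<noteq> g i"
      by metis
    have dist_1: "dist_edges ?E (cyc_vert n i) (color_class ?E c a) = 1"
      if a: "g (i - 1) \<noteq> a" "g i \<noteq> a" "g (i + 1) = a \<or> g (i - 2) = a" for a i
    proof -
      have avoid: "cyc_vert n i \<notin> e" if "e \<in> color_class ?E c a" for e
        using that a cyc_vert_incident[OF n0, of e i] by (auto simp: color_class_def g_def)
      have in_class: "cyc_edge n j \<in> color_class ?E c a \<longleftrightarrow> g j = a" for j
        using edge by (simp add: color_class_def g_def)
      have "cyc_vert n (i + 1) \<in> cyc_edge n (i + 1)" "{cyc_vert n i, cyc_vert n (i + 1)} \<in> ?E"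
        "cyc_vert n (i - 1) \<in> cyc_edge n (i - 2)" "{cyc_vert n i, cyc_vert n (i - 1)} \<in> ?E"
        using edge[of i] edge[of "i - 1"] by (simp_all add: cyc_edge_def insert_commute)
      then obtain e y where "e \<in> color_class ?E c a" "y \<in> e" "{cyc_vert n i, y} \<in> ?E"
        using a(3) in_class by blast
      moreover have "color_class ?E c a \<subseteq> ?E" by (auto simp: color_class_def)
      ultimately show ?thesis
        using dist_edges_eq_1[OF n cyc_vert_less[OF n0]] avoid by blast
    qed
    \<comment> \<open>Of three colors, the two other than \<open>a\<close> occur at each such vertex
      and give entries 0, while \<open>dist_1\<close> gives entry 1 for \<open>a\<close>. Hence the
      codes agree.\<close>
    have near_unique: "i mod int n = j mod int n"
      if a: "a \<in> {1..k}" and i: "g (i - 1) \<noteq> a" "g i \<noteq> a" "g (i + 1) = a \<or> g (i - 2) = a"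
        and j: "g (j - 1) \<noteq> a" "g j \<noteq> a" "g (j + 1) = a \<or> g (j - 2) = a" for a i j
    proof -
      have other: "b = g (l - 1) \<or> b = g l"
        if b: "b \<in> {1..k}" "b \<noteq> a" "g (l - 1) \<noteq> a" "g l \<noteq> a" for b l
      proof -
        have "b = x \<or> b = y" if "x \<in> {1..k}" "y \<in> {1..k}" "x \<noteq> y" "x \<noteq> a" "y \<noteq> a" for x y
          using that a b(1,2) k unfolding atLeastAtMost_iff by presburger
        then show ?thesis using b g_in g_neq by blast
      qed
      have "cyc_vert n i = cyc_vert n j"
      proof (rule same_vertex)
        fix b assume b: "b \<in> {1..k}"
        show "dist_edges ?E (cyc_vert n i) (color_class ?E c b)
          = dist_edges ?E (cyc_vert n j) (color_class ?E c b)"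
        proof (cases "b = a")
          case True
          then show ?thesis using dist_1[OF i] dist_1[OF j] by simp
        next
          case False
          show ?thesis
            using dist_0[OF b] other[OF b False i(1,2)] other[OF b False j(1,2)] by metis
        qed
      qed
      then show ?thesis using cyc_vert_eq_iff[OF n0] by simp
    qed
    \<comment> \<open>Each of the three colors is missed by at most one vertex, which bounds
      \<open>n\<close> by 3.\<close>
    have "inj_on (\<lambda>v. miss (int v)) {0..<n}"
    proof (rule inj_onI)
      fix v w assume vw: "v \<in> {0..<n}" "w \<in> {0..<n}" "miss (int v) = miss (int w)"
      define a where "a = miss (int v)"
      have a: "a \<in> {1..k}" using miss by (simp add: a_def)
      have "a \<in> c ` ?E" using a colors by simp
      then obtain i0 where i0: "g i0 = a"
        unfolding cycle_edges_eq_range[OF n0] g_def by blast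
      have missing: "g (int v - 1) \<noteq> a" "g (int v) \<noteq> a" "g (int w - 1) \<noteq> a" "g (int w) \<noteq> a"
        using miss(2,3) vw(3) unfolding a_def by metis+
      have periodic: "g i = g j" if "i mod int n = j mod int n" for i j
        unfolding g_def cyc_edge_cong[OF n0 that] ..
      have "int n > 0" using n0 by simp
      from periodic i0 this near_unique[OF a] missing
      have "int v mod int n = int w mod int n" by (rule missing_vertices_cong)
      then show "v = w" using vw by simp
    qed
    then have "card {0..<n} \<le> card {1..k}"
      using miss(1) by (intro card_inj_on_le[where f = "\<lambda>v. miss (int v)"]) auto
    then show ?thesis using k n by simp
  qed
  ultimately show ?thesis by (cases "k = 3") auto
qed

section \<open>Upper bound: an explicit locating coloring\<close>

lemma locating_coloring_cycle_exists:
  assumes n: "n \<ge> 3"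
  shows "\<exists>c. edge_locating_coloring (cycle_verts n) (cycle_edges n) (if n = 3 then 3 else 4) c"
proof -
  let ?E = "cycle_edges n" and ?k = "if n = 3 then 3 else 4 :: nat"
  have n0: "n > 0" using n by simp
  define ed where "ed i = {i, (i + 1) mod n}" for i
  \<comment> \<open>Edges 0 and 1 get the private colors 1 and 2. The rest alternates between 3 and
    4 along a path, so the parity of \<open>n\<close> does not matter; for \<open>n = 3\<close> only
    edge 2 remains and color 4 does not occur.\<close>
  define h where "h i = (if i = 0 then 1 else if i = 1 then 2 else if even i then 3 else 4 :: nat)"
    for i :: nat
  \<comment> \<open>A coloring takes edges as arguments, so the index is recovered from the edge;
    \<open>ed_inj\<close> makes it unique.\<close>
  define c where "c e = h (THE i. i < n \<and> e = ed i)" for e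
  have succ: "Suc i mod n = (if Suc i = n then 0 else Suc i)" if "i < n" for i
    using that by auto
  have E: "?E = ed ` {0..<n}" by (auto simp: cycle_edges_def ed_def)
  have ed_inj: "i = j" if "i < n" "j < n" "ed i = ed j" for i j
    using that n by (auto simp: ed_def succ doubleton_eq_iff split: if_splits)
  have c_ed: "c (ed i) = h i" if "i < n" for i
    unfolding c_def using that ed_inj by (metis (mono_tags, lifting) the_equality)
  have c_image: "c ` ?E = h ` {0..<n}" unfolding E image_image using c_ed by simp
  also have "\<dots> = {1..?k}"
  proof (cases "n = 3")
    case True
    then show ?thesis by (auto simp: h_def numeral_3_eq_3 atLeastLessThanSuc)
  next
    case False
    \<comment> \<open>For \<open>n \<ge> 4\<close> the first four edges already use all four
      colors.\<close>
    have "h ` {0..<n} \<supseteq> h ` {0, 1, 2, 3}" using False n by (intro image_mono) auto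
    moreover have "h ` {0, 1, 2, 3} = {1..4}" by (auto simp: h_def)
    moreover have "h ` {0..<n} \<subseteq> {1..4}" by (auto simp: h_def)
    ultimately have "h ` {0..<n} = {1..4}" by (metis subset_antisym)
    then show ?thesis using False by simp
  qed
  finally have colors: "c ` ?E = {1..?k}" .
  have proper: "c e \<noteq> c f" if ef: "e \<in> ?E" "f \<in> ?E" "e \<noteq> f" "e \<inter> f \<noteq> {}" for e f
  proof -
    obtain i j where ij: "i < n" "j < n" "e = ed i" "f = ed j"
      using ef(1,2) by (metis E atLeastLessThan_iff imageE)
    have "Suc i = j \<or> Suc j = i \<or> i = 0 \<and> Suc j = n \<or> j = 0 \<and> Suc i = n"
      using ef ij by (auto simp: ed_def succ split: if_splits)
    then have "h i \<noteq> h j" using n by (auto simp: h_def split: if_splits)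
    then show ?thesis using c_ed ij by simp
  qed
  have singleton_class: "color_class ?E c (Suc i) = {{i, Suc i}}" if "i < 2" for i
  proof -
    have "ed i = {i, Suc i}" using that n by (auto simp: ed_def)
    moreover have "h j = Suc i \<longleftrightarrow> j = i" for j using that by (auto simp: h_def split: if_splits)
    moreover have "color_class ?E c (Suc i) = ed ` {j \<in> {0..<n}. h j = Suc i}"
      using c_ed by (auto simp: color_class_def E)
    moreover have "{j \<in> {0..<n}. j = i} = {i}" using that n by auto
    ultimately show ?thesis by simp
  qed
  have dist: "dist_edges ?E v (color_class ?E c (Suc i))
      = min (cycle_dist n v i) (cycle_dist n v (Suc i))" if "i < 2" "v < n" for i v
    using that n singleton_class by (simp add: dist_edges_def dist_edge_def graph_dist_cycle)
  have dist_first: "min (cycle_dist n v 0) (cycle_dist n v 1)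
      = (if v \<le> 1 then 0 else min (v - 1) (n - v))" if "v < n" for v
  proof (cases "v = 0")
    case True
    then show ?thesis by (simp add: cycle_dist_def)
  next
    case False
    then have "min (cycle_dist n v 0) (cycle_dist n v 1) = min (v - 1) (n - v)"
      using cycle_dist_edge[of 0 v n] that by (simp only: One_nat_def diff_zero)
    then show ?thesis using False by (cases "v = 1") simp_all
  qed
  have dist_second: "min (cycle_dist n v 1) (cycle_dist n v 2)
      = (if v = 0 then 1 else if v = 1 then 0 else min (v - 2) (Suc n - v))" if "v < n" for v
  proof -
    consider "v = 0" | "v = 1" | "v \<ge> 2" by linarith
    then show ?thesis
    proof cases
      case 3
      then have "n - (v - 1) = Suc n - v" by simp
      then have "min (cycle_dist n v 1) (cycle_dist n v 2) = min (v - 2) (Suc n - v)"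
        using 3 that cycle_dist_edge[of 1 v n] by (simp only: Suc_1)
      then show ?thesis using 3 by simp
    qed (use n in \<open>simp_all add: cycle_dist_def\<close>)
  qed
  have "inj_on (edge_color_code ?E ?k c) {0..<n}"
  proof (rule inj_onI)
    fix v w assume vw: "v \<in> {0..<n}" "w \<in> {0..<n}"
      "edge_color_code ?E ?k c v = edge_color_code ?E ?k c w"
    have "dist_edges ?E v (color_class ?E c (Suc i)) = dist_edges ?E w (color_class ?E c (Suc i))"
      if "i < 2" for i
      using vw(3) that by (auto simp: edge_color_code_eq_iff)
    then have eq: "min (cycle_dist n v i) (cycle_dist n v (Suc i))
        = min (cycle_dist n w i) (cycle_dist n w (Suc i))" if "i < 2" for i
      using that dist vw by simp
    have v: "v < n" and w: "w < n" using vw by auto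
    have "min (cycle_dist n v 0) (cycle_dist n v 1) = min (cycle_dist n w 0) (cycle_dist n w 1)"
      using eq[of 0] by (simp only: One_nat_def zero_less_numeral)
    then have first: "(if v \<le> 1 then 0 else min (v - 1) (n - v))
        = (if w \<le> 1 then 0 else min (w - 1) (n - w))"
      unfolding dist_first[OF v] dist_first[OF w] .
    have "min (cycle_dist n v 1) (cycle_dist n v 2) = min (cycle_dist n w 1) (cycle_dist n w 2)"
      using eq[of 1] by (simp only: Suc_1 one_less_numeral_iff semiring_norm)
    then have second: "(if v = 0 then 1 else if v = 1 then 0 else min (v - 2) (Suc n - v))
        = (if w = 0 then 1 else if w = 1 then 0 else min (w - 2) (Suc n - w))"
      unfolding dist_second[OF v] dist_second[OF w] .
    show "v = w"
    \<comment> \<open>The first distance is 0 only at the ends of the edge between 0 and 1, and the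
      second distance separates these two ends.\<close>
    proof (cases "v \<le> 1 \<or> w \<le> 1")
      case True
      then have "v \<le> 1 \<and> w \<le> 1"
        using first v w by (auto simp: min_def split: if_splits)
      then have "v = 0 \<or> v = 1" "w = 0 \<or> w = 1" by auto
      then show ?thesis using second by (elim disjE; hypsubst; simp)
    next
      case False
      then have ge: "v \<ge> 2" "w \<ge> 2" by auto
      \<comment> \<open>Away from the two edges, \<open>p\<close> counts the steps from
        \<open>v\<close> down to vertex 2 and \<open>q\<close> the steps up to vertex 0. Their sum
        is always \<open>n - 2\<close>.\<close>
      define p q p' q' where pq: "p = v - 2" "q = n - v" "p' = w - 2" "q' = n - w"
      have sums: "p + q = p' + q'" using v w ge by (simp add: pq)
      have "v - 1 = Suc p" "w - 1 = Suc p'" "Suc n - v = Suc q" "Suc n - w = Suc q'"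
        using ge v w by (auto simp: pq)
      moreover have "\<not> v \<le> 1" "\<not> w \<le> 1" "v \<noteq> 0" "w \<noteq> 0" "v \<noteq> 1" "w \<noteq> 1" using ge by auto
      ultimately have "min (Suc p) q = min (Suc p') q'" "min p (Suc q) = min p' (Suc q')"
        using first second by (simp_all only: if_False flip: pq)
      \<comment> \<open>The first minimum minus the second is 1, 0 or -1 according to whether
        \<open>p < q\<close>, \<open>p = q\<close> or \<open>p > q\<close>. Knowing the case, the
        second minimum gives \<open>p\<close> or \<open>Suc q\<close>, and the fixed sum gives
        \<open>p\<close>.\<close>
      then have "p = p'" using sums by (auto simp: min_def split: if_splits)
      then show ?thesis using ge by (simp add: pq)
    qed
  qed
  then show ?thesis using colors proper
    unfolding edge_locating_coloring_def proper_edge_coloring_def cycle_verts_def by blast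
qed

theorem theorem2:
  fixes n :: nat
  assumes "n \<ge> 3"
  shows "edge_locating_chromatic_number (cycle_verts n) (cycle_edges n)
           = (if n = 3 then 3 else 4)"
  unfolding edge_locating_chromatic_number_def
proof (rule Least_equality)
  show "\<exists>c. edge_locating_coloring (cycle_verts n) (cycle_edges n) (if n = 3 then 3 else 4) c"
    by (rule locating_coloring_cycle_exists[OF assms])
  show "(if n = 3 then 3 else 4) \<le> k"
    if "\<exists>c. edge_locating_coloring (cycle_verts n) (cycle_edges n) k c" for k
    using that by (elim exE) (rule locating_coloring_cycle_lower[OF assms])
qed

end
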